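(* Every $3$-edge-connected graph $G$ satisfies $fn(G)\le 4$.
   Context: All graphs are finite. An orientation $(G,o)$ of a graph $G$ assigns to each edge one of its two directions. An orientation is strong if for every ordered pair of distinct vertices $u,v$ there is a directed $uv$-path. An edge $e$ is deletable in an orientation $(G,o)$ if the restriction of $o$ to $E(G)\setminus\{e\}$ is a strong orientation of $G-e$. For a $3$-edge-connected graph $G$, the Frank number $fn(G)$ is the minimum number $k$ such that $G$ admits $k$ orientations with the property that every edge of $G$ is deletable in at least one of them. *)

theory Defs
  imports Main
begin

text \<open>Finite (multi)graphs: vertex set V, edge set E, and a map ends giving each edge
its two (distinct) endpoints, listed in an arbitrary reference order.
Parallel edges are allowed; loops are not.\<close>

definition graph :: "'v set \<Rightarrow> 'e set \<Rightarrow> ('e \<Rightarrow> 'v \<times> 'v) \<Rightarrow> bool" where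
  "graph V E ends \<longleftrightarrow> finite V \<and> finite E \<and>
     (\<forall>e\<in>E. fst (ends e) \<in> V \<and> snd (ends e) \<in> V \<and> fst (ends e) \<noteq> snd (ends e))"

text \<open>Undirected adjacency relation of the edge set F.\<close>
definition undir_arcs :: "'e set \<Rightarrow> ('e \<Rightarrow> 'v \<times> 'v) \<Rightarrow> ('v \<times> 'v) set" where
  "undir_arcs F ends = {ends e | e. e \<in> F} \<union> {prod.swap (ends e) | e. e \<in> F}"

definition connected_graph :: "'v set \<Rightarrow> 'e set \<Rightarrow> ('e \<Rightarrow> 'v \<times> 'v) \<Rightarrow> bool" where
  "connected_graph V F ends \<longleftrightarrow>
     (\<forall>u\<in>V. \<forall>v\<in>V. (u, v) \<in> (undir_arcs F ends)\<^sup>*)"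

text \<open>k-edge-connected: deleting any fewer than k edges leaves the graph connected.\<close>
definition k_edge_connected :: "nat \<Rightarrow> 'v set \<Rightarrow> 'e set \<Rightarrow> ('e \<Rightarrow> 'v \<times> 'v) \<Rightarrow> bool" where
  "k_edge_connected k V E ends \<longleftrightarrow>
     (\<forall>F. F \<subseteq> E \<longrightarrow> card F < k \<longrightarrow> connected_graph V (E - F) ends)"

text \<open>An orientation o assigns to each edge one of its two directions:
o e = True means e is directed from fst (ends e) to snd (ends e), otherwise reversed.\<close>
definition arcs :: "'e set \<Rightarrow> ('e \<Rightarrow> 'v \<times> 'v) \<Rightarrow> ('e \<Rightarrow> bool) \<Rightarrow> ('v \<times> 'v) set" where
  "arcs F ends ori = {(if ori e then ends e else prod.swap (ends e)) | e. e \<in> F}"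

text \<open>Strong orientation of the graph (V,F): every ordered pair of distinct vertices
is joined by a directed path.\<close>
definition strong :: "'v set \<Rightarrow> 'e set \<Rightarrow> ('e \<Rightarrow> 'v \<times> 'v) \<Rightarrow> ('e \<Rightarrow> bool) \<Rightarrow> bool" where
  "strong V F ends ori \<longleftrightarrow>
     (\<forall>u\<in>V. \<forall>v\<in>V. u \<noteq> v \<longrightarrow> (u, v) \<in> (arcs F ends ori)\<^sup>+)"

definition deletable :: "'v set \<Rightarrow> 'e set \<Rightarrow> ('e \<Rightarrow> 'v \<times> 'v) \<Rightarrow> ('e \<Rightarrow> bool) \<Rightarrow> 'e \<Rightarrow> bool" where
  "deletable V E ends ori e \<longleftrightarrow> strong V (E - {e}) ends ori"

definition frank_number :: "'v set \<Rightarrow> 'e set \<Rightarrow> ('e \<Rightarrow> 'v \<times> 'v) \<Rightarrow> nat" where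
  "frank_number V E ends =
     (LEAST k. \<exists>os :: ('e \<Rightarrow> bool) list. length os = k \<and>
                  (\<forall>e\<in>E. \<exists>ori\<in>set os. deletable V E ends ori e))"

end

theory Submission
  imports Defs
begin

text \<open>Orient every edge along a nowhere-zero integer flow. In a cut with at least three edges, an
edge that is alone in its direction carries the total of at least two positive values, so an edge
of flow value 1 is deletable. It therefore suffices to find four nowhere-zero flows such that
every edge has value 1 or -1 in one of them. Seymour's proof of the 6-flow theorem, run directly
on a 3-edge-connected graph, gives an even subgraph C and a ternary flow that is nonzero off C. Let
g be a flow with values 1 and -1 on C and 0 elsewhere, h an integer form of the ternary flow
with values of modulus at most 2, k a flow with values 1 and -1 exactly on the odd edges of h,
and h' = -(h + 3k)/2. The four flows are -3g + h, 3g + h', 2h + g and 2h' - g.\<close>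

section \<open>Flows and cuts\<close>

locale multigraph =
  fixes V :: "'v set" and E :: "'e set" and ends :: "'e \<Rightarrow> 'v \<times> 'v"
  assumes graph: "graph V E ends"
begin

lemma finite_V [simp]: "finite V" and finite_E [simp]: "finite E"
  using graph by (auto simp: graph_def)

lemma fst_in_V: "e \<in> E \<Longrightarrow> fst (ends e) \<in> V"
  and snd_in_V: "e \<in> E \<Longrightarrow> snd (ends e) \<in> V"
  and no_loop: "e \<in> E \<Longrightarrow> fst (ends e) \<noteq> snd (ends e)"
  using graph by (auto simp: graph_def)

text \<open>The coboundary of the indicator of \<open>S\<close>: 1 if the reference direction of
  \<open>e\<close> leaves \<open>S\<close>, -1 if it enters \<open>S\<close>, 0 if \<open>e\<close>
  does not cross. As a difference of indicators it is additive over the vertices of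
  \<open>S\<close>, so conservation at vertices passes to cuts.\<close>

definition dir :: "'e \<Rightarrow> 'v set \<Rightarrow> int" where
  "dir e S = of_bool (fst (ends e) \<in> S) - of_bool (snd (ends e) \<in> S)"

definition inside :: "'e \<Rightarrow> 'v set \<Rightarrow> bool" where
  "inside e S \<longleftrightarrow> fst (ends e) \<in> S \<and> snd (ends e) \<in> S"

definition net :: "('e \<Rightarrow> int) \<Rightarrow> 'v set \<Rightarrow> int" where
  "net f S = (\<Sum>e\<in>E. f e * dir e S)"

definition circulation :: "('e \<Rightarrow> int) \<Rightarrow> bool" where
  "circulation f \<longleftrightarrow> (\<forall>v. net f {v} = 0)"

text \<open>Not a path but any integer flow sending one unit from \<open>a\<close> to
  \<open>b\<close>. Only the boundary is prescribed, so concatenation is addition and reversal is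
  negation, with no walks to handle.\<close>

definition unit_path :: "('e \<Rightarrow> int) \<Rightarrow> 'v \<Rightarrow> 'v \<Rightarrow> bool" where
  "unit_path p a b \<longleftrightarrow> (\<forall>v. net p {v} = of_bool (v = a) - of_bool (v = b))"

definition single :: "'e \<Rightarrow> int \<Rightarrow> 'e \<Rightarrow> int" where
  "single e s = (\<lambda>e'. if e' = e then s else 0)"

lemma dir_cases: "dir e S \<in> {-1, 0, 1}"
  by (auto simp: dir_def)

lemma dir_nonzero_iff: "dir e S \<noteq> 0 \<longleftrightarrow> (fst (ends e) \<in> S) \<noteq> (snd (ends e) \<in> S)"
  by (simp add: dir_def)

lemma net_add: "net (\<lambda>e. f e + g e) S = net f S + net g S"
  by (simp add: net_def algebra_simps sum.distrib)

lemma net_diff: "net (\<lambda>e. f e - g e) S = net f S - net g S"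
  by (simp add: net_def algebra_simps sum_subtractf)

lemma net_scale: "net (\<lambda>e. k * f e) S = k * net f S"
  by (simp add: net_def sum_distrib_left mult.assoc)

lemma net_uminus: "net (\<lambda>e. - f e) S = - net f S"
  by (simp add: net_def sum_negf)

lemma net_zero [simp]: "net (\<lambda>e. 0) S = 0"
  by (simp add: net_def)

lemma net_sum: "net (\<lambda>e. \<Sum>i\<in>I. f i e) S = (\<Sum>i\<in>I. net (f i) S)"
  unfolding net_def by (simp add: sum_distrib_right sum.swap[of _ I])

lemma net_single: "e \<in> E \<Longrightarrow> net (single e s) S = s * dir e S"
  unfolding net_def single_def by (simp add: if_distrib[of "\<lambda>x. x * _"] cong: if_cong)

lemma dir_eq_sum: "finite S \<Longrightarrow> dir e S = (\<Sum>v\<in>S. dir e {v})"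
  by (simp add: dir_def sum_subtractf of_bool_def)

lemma net_eq_sum:
  assumes "finite S" shows "net f S = (\<Sum>v\<in>S. net f {v})"
proof -
  have "net f S = (\<Sum>e\<in>E. \<Sum>v\<in>S. f e * dir e {v})"
    unfolding net_def by (simp add: dir_eq_sum[OF assms] sum_distrib_left)
  also have "\<dots> = (\<Sum>v\<in>S. net f {v})"
    unfolding net_def by (rule sum.swap)
  finally show ?thesis .
qed

lemma net_V: "net f V = 0"
  unfolding net_def by (rule sum.neutral) (simp add: dir_def fst_in_V snd_in_V)

lemma net_cong: "(\<And>e. e \<in> E \<Longrightarrow> f e = g e) \<Longrightarrow> net f S = net g S"
  by (simp add: net_def)

lemma circulation_net: "circulation f \<Longrightarrow> finite S \<Longrightarrow> net f S = 0"
  by (subst net_eq_sum) (auto simp: circulation_def)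

lemma unit_path_net:
  assumes "unit_path p a b" "finite S"
  shows "net p S = of_bool (a \<in> S) - of_bool (b \<in> S)"
  using assms by (subst net_eq_sum) (auto simp: unit_path_def sum_subtractf of_bool_def)

lemma unit_path_refl: "unit_path (\<lambda>e. 0) a a"
  by (simp add: unit_path_def)

lemma unit_path_trans:
  "unit_path p a b \<Longrightarrow> unit_path q b c \<Longrightarrow> unit_path (\<lambda>e. p e + q e) a c"
  by (simp add: unit_path_def net_add)

lemma unit_path_sym: "unit_path p a b \<Longrightarrow> unit_path (\<lambda>e. - p e) b a"
  by (simp add: unit_path_def net_uminus)

lemma unit_path_single:
  "e \<in> E \<Longrightarrow> unit_path (single e 1) (fst (ends e)) (snd (ends e))"
  by (auto simp: unit_path_def net_single dir_def)

text \<open>The sign \<open>s\<close> absorbs the reference direction of a crossing edge, so that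
  later arguments can always traverse it from inside \<open>S\<close> to outside.\<close>

lemma unit_path_leaving:
  assumes "e \<in> E" "dir e S \<noteq> 0"
  obtains x y s where "x \<in> S" "y \<notin> S" "(x, y) = ends e \<or> (y, x) = ends e"
    "s = 1 \<or> s = -1" "unit_path (single e s) x y"
proof (cases "fst (ends e) \<in> S")
  case True
  then show thesis
    using assms that[of "fst (ends e)" "snd (ends e)" 1] unit_path_single[of e]
    by (auto simp: dir_def)
next
  case False
  have "unit_path (single e (-1)) (snd (ends e)) (fst (ends e))"
    using unit_path_sym[OF unit_path_single[OF assms(1)]]
    by (simp add: single_def if_distrib[of uminus] cong: if_cong)
  then show thesis
    using False assms that[of "snd (ends e)" "fst (ends e)" "-1"]
    by (auto simp: dir_def)
qed

definition arc_path :: "('e \<Rightarrow> int \<Rightarrow> bool) \<Rightarrow> 'v set \<Rightarrow> ('e \<Rightarrow> int) \<Rightarrow> 'v \<Rightarrow> 'v \<Rightarrow> bool" where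
  "arc_path A U p a b \<longleftrightarrow> unit_path p a b \<and>
     (\<forall>e\<in>E. p e \<in> {-1, 0, 1} \<and> (p e \<noteq> 0 \<longrightarrow> inside e U \<and> A e (p e)))"

text \<open>Growing the reachable set one vertex at a time attaches each new vertex by an edge that
was not inside the old set, so the resulting paths use every edge at most once.\<close>

lemma reachable_set:
  assumes "a \<in> B" "B \<subseteq> V"
  shows "\<exists>U. a \<in> U \<and> U \<subseteq> B \<and> (\<forall>u\<in>U. \<exists>p. arc_path A U p a u) \<and>
    (\<forall>e\<in>E. inside e B \<and> dir e U \<noteq> 0 \<longrightarrow> \<not> A e (dir e U))"
proof -
  define Q where "Q U \<longleftrightarrow> a \<in> U \<and> U \<subseteq> B \<and> (\<forall>u\<in>U. \<exists>p. arc_path A U p a u)" for U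
  have "finite B" using assms(2) finite_V finite_subset by blast
  then have fin: "finite {U. Q U}"
    by (rule finite_subset[rotated, OF finite_Pow_iff[THEN iffD2]]) (auto simp: Q_def)
  have "Q {a}"
    using assms unit_path_refl by (auto simp: Q_def arc_path_def intro!: exI[of _ "\<lambda>e. 0"])
  then obtain U where U: "Q U" and max: "\<And>U'. Q U' \<Longrightarrow> U \<subseteq> U' \<Longrightarrow> U' = U"
    using finite_has_maximal[OF fin] by blast
  have "\<not> A e (dir e U)" if e: "e \<in> E" "inside e B" "dir e U \<noteq> 0" for e
  proof
    assume A: "A e (dir e U)"
    obtain x y s where xy: "x \<in> U" "y \<notin> U" "(x, y) = ends e \<or> (y, x) = ends e"
      "s = 1 \<or> s = -1" "unit_path (single e s) x y"
      using unit_path_leaving[OF e(1,3)] by metis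
    have yB: "y \<in> B" using xy(3) e(2) by (auto simp: inside_def prod_eq_iff)
    have "finite U" using U \<open>finite B\<close> by (auto simp: Q_def intro: finite_subset)
    \<comment> \<open>The unit sent along \<open>e\<close> crosses out of \<open>U\<close>, which
      identifies its sign with \<open>dir e U\<close>, the very sign that \<open>A\<close>
      permits.\<close>
    then have "s * dir e U = 1"
      using unit_path_net[OF xy(5)] xy(1,2) net_single[OF e(1)] by simp
    then have s: "s = dir e U" using xy(4) by auto
    obtain p where p: "arc_path A U p a x" using U xy(1) by (auto simp: Q_def)
    have pe: "p e = 0" using p e(1) xy(2,3) by (auto simp: arc_path_def inside_def prod_eq_iff)
    have mono: "inside e' (insert y U)" if "inside e' U" for e'
      using that by (auto simp: inside_def)
    have "inside e (insert y U)" using xy by (auto simp: inside_def prod_eq_iff)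
    moreover have "unit_path (\<lambda>e'. p e' + single e s e') a y"
      using p xy(5) unit_path_trans by (auto simp: arc_path_def)
    ultimately have "arc_path A (insert y U) (\<lambda>e'. p e' + single e s e') a y"
      using p pe A s xy(4) mono by (auto simp: arc_path_def single_def)
    moreover have "\<exists>p. arc_path A (insert y U) p a u" if "u \<in> U" for u
    proof -
      obtain p where "arc_path A U p a u" using U \<open>u \<in> U\<close> by (auto simp: Q_def)
      then have "arc_path A (insert y U) p a u" using mono by (auto simp: arc_path_def)
      then show ?thesis by blast
    qed
    ultimately have "Q (insert y U)" using U yB by (auto simp: Q_def)
    then show False using max[of "insert y U"] xy(2) by auto
  qed
  then show ?thesis using U unfolding Q_def by blast
qed

section \<open>Integer flows from modular flows\<close>

text \<open>Tutte's rounding of a modular flow: subtracting the modulus along a positive path from an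
excess vertex to a deficient one keeps all values in range and lowers the total imbalance.\<close>

lemma modular_flow_rounding:
  fixes k :: int
  assumes k: "k > 0" and f: "\<And>v. k dvd net f {v}"
  obtains g where "circulation g" "\<And>e. e \<in> E \<Longrightarrow> k dvd f e - g e" "\<And>e. e \<in> E \<Longrightarrow> \<bar>g e\<bar> < k"
proof -
  define P where "P g \<longleftrightarrow> (\<forall>e\<in>E. k dvd f e - g e \<and> \<bar>g e\<bar> < k)" for g
  define m where "m g = (\<Sum>v\<in>V. nat \<bar>net g {v}\<bar>)" for g
  have "P (\<lambda>e. f e mod k)" using k by (auto simp: P_def mod_eq_dvd_iff[symmetric])
  then obtain g where g: "P g" and min: "\<And>g'. P g' \<Longrightarrow> m g \<le> m g'"
    using ex_has_least_nat[of P _ m] by blast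
  have dvd: "k dvd net g {v}" for v
  proof -
    have "k dvd net (\<lambda>e. f e - g e) {v}"
      unfolding net_def by (rule dvd_sum) (use g in \<open>auto simp: P_def\<close>)
    then have "k dvd net f {v} - net g {v}" by (simp add: net_diff)
    then show ?thesis using f dvd_diff_right_iff by blast
  qed
  have zero: "net g {v} = 0" if "v \<in> V" for v
  proof (rule ccontr)
    assume "net g {v} \<noteq> 0"
    have "\<exists>a\<in>V. net g {a} > 0"
    proof (rule ccontr)
      assume "\<not> ?thesis"
      then have le: "\<forall>a\<in>V. net g {a} \<le> 0" by auto
      have "(\<Sum>v\<in>V. net g {v}) = 0" using net_eq_sum[of V g] net_V by simp
      then show False
        using sum_nonneg_eq_0_iff[of V "\<lambda>v. - net g {v}"] le \<open>v \<in> V\<close> \<open>net g {v} \<noteq> 0\<close> by (auto simp: sum_negf)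
    qed
    then obtain a where a: "a \<in> V" "net g {a} > 0" by blast
    obtain U where U: "a \<in> U" "U \<subseteq> V"
      "\<forall>u\<in>U. \<exists>p. arc_path (\<lambda>e s. s * g e > 0) U p a u"
      "\<forall>e\<in>E. inside e V \<and> dir e U \<noteq> 0 \<longrightarrow> \<not> dir e U * g e > 0"
      using reachable_set[OF a(1) order_refl, of "\<lambda>e s. s * g e > 0"] by blast
    have "finite U" using U(2) finite_V finite_subset by blast
    \<comment> \<open>\<open>U\<close> is closed under following positive flow, so no flow of
      \<open>g\<close> leaves it. The excess at \<open>a\<close> must therefore be balanced by a
      deficient vertex within \<open>U\<close>.\<close>
    have "net g U \<le> 0" unfolding net_def
      by (rule sum_nonpos) (use U(4) in \<open>force simp: inside_def fst_in_V snd_in_V mult.commute\<close>)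
    have "\<exists>w\<in>U. net g {w} < 0"
    proof (rule ccontr)
      assume "\<not> ?thesis"
      then have "net g {w} \<ge> 0" if "w \<in> U" for w using that by auto
      then have "(\<Sum>w\<in>U. net g {w}) > 0"
        by (intro sum_pos2[of U a "\<lambda>w. net g {w}"]) (use \<open>finite U\<close> U(1) a(2) in auto)
      then show False using \<open>net g U \<le> 0\<close> net_eq_sum[OF \<open>finite U\<close>, of g] by simp
    qed
    then obtain w where w: "w \<in> U" "net g {w} < 0" by blast
    obtain p where p: "unit_path p a w"
      "\<And>e. e \<in> E \<Longrightarrow> p e \<in> {-1, 0, 1}" "\<And>e. e \<in> E \<Longrightarrow> p e \<noteq> 0 \<Longrightarrow> p e * g e > 0"
      using U(3) w(1) unfolding arc_path_def by blast
    \<comment> \<open>Where \<open>p\<close> is nonzero it has the sign of \<open>g\<close>, so a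
      modulus between 1 and \<open>k - 1\<close> turns into \<open>k\<close> minus itself and stays
      in that range.\<close>
    define g' where "g' = (\<lambda>e. g e - k * p e)"
    have "P g'" unfolding P_def
    proof
      fix e assume e: "e \<in> E"
      have "k dvd f e - g e" "\<bar>g e\<bar> < k" using g e by (auto simp: P_def)
      moreover have "f e - g' e = (f e - g e) + k * p e" by (simp add: g'_def)
      moreover have "\<bar>g' e\<bar> < k"
        using p(2,3)[OF e] \<open>\<bar>g e\<bar> < k\<close> by (auto simp: g'_def)
      ultimately show "k dvd f e - g' e \<and> \<bar>g' e\<bar> < k"
        by (metis dvd_add dvd_triv_left)
    qed
    have n: "net g' {v} = net g {v} - k * (of_bool (v = a) - of_bool (v = w))" for v
      using p(1) by (simp add: g'_def net_diff net_scale unit_path_def)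
    have "w \<noteq> a" using a w by auto
    \<comment> \<open>Imbalances are multiples of \<open>k\<close>, so the excess at
      \<open>a\<close> and the deficit at \<open>w\<close> are both at least \<open>k\<close>.
      Shifting \<open>k\<close> units reduces each without passing zero.\<close>
    have ka: "net g {a} \<ge> k" using dvd[of a] a(2) zdvd_imp_le by blast
    have "m g' < m g" unfolding m_def
    proof (rule sum_strict_mono_ex1)
      have "net g {w} \<le> - k" using dvd[of w] w(2) zdvd_imp_le[of k "- net g {w}"] by simp
      then show "\<forall>v\<in>V. nat \<bar>net g' {v}\<bar> \<le> nat \<bar>net g {v}\<bar>"
        using n ka k \<open>w \<noteq> a\<close> by (auto simp: of_bool_def)
      show "\<exists>v\<in>V. nat \<bar>net g' {v}\<bar> < nat \<bar>net g {v}\<bar>"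
        using a(1) ka k \<open>w \<noteq> a\<close> n[of a] by (intro bexI[of _ a]) auto
    qed simp
    then show False using min[OF \<open>P g'\<close>] by simp
  qed
  have "net g {v} = 0" if "v \<notin> V" for v
    unfolding net_def
    by (rule sum.neutral) (use that fst_in_V snd_in_V in \<open>force simp: dir_def\<close>)
  with zero have "circulation g" by (auto simp: circulation_def)
  then show thesis using that g by (auto simp: P_def)
qed

section \<open>Even subgraphs through two vertices of a block\<close>

text \<open>Two edge-disjoint paths from one augmentation step: the second path may cancel but not
reuse the edges of the first.\<close>

lemma connected_even_subgraph:
  assumes B: "B \<subseteq> V" "b1 \<in> B" "b2 \<in> B"
    and cut: "\<And>A. A \<subseteq> B \<Longrightarrow> A \<noteq> {} \<Longrightarrow> A \<noteq> B \<Longrightarrow> 2 \<le> card {e\<in>E. inside e B \<and> dir e A \<noteq> 0}"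
  obtains W y where "b1 \<in> W" "b2 \<in> W" "W \<subseteq> B" "\<And>v. even (net y {v})"
    "\<And>e. e \<in> E \<Longrightarrow> \<not> inside e W \<Longrightarrow> y e = 0"
    "\<And>w. w \<in> W \<Longrightarrow> \<exists>p. unit_path p b1 w \<and> (\<forall>e\<in>E. p e \<noteq> 0 \<longrightarrow> odd (y e))"
proof (cases "b1 = b2")
  case True
  then show thesis
    using that[of "{b1}" "\<lambda>e. 0"] B unit_path_refl by (auto intro!: exI[of _ "\<lambda>e. 0"])
next
  case False
  have finB: "U \<subseteq> B \<Longrightarrow> finite U" for U
    using finite_subset[OF _ finite_subset[OF B(1) finite_V]] by simp
  obtain U1 where U1: "b1 \<in> U1" "U1 \<subseteq> B"
    "\<forall>u\<in>U1. \<exists>p. arc_path (\<lambda>_ _. True) U1 p b1 u"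
    "\<forall>e\<in>E. inside e B \<and> dir e U1 \<noteq> 0 \<longrightarrow> \<not> True"
    using reachable_set[OF B(2,1), of "\<lambda>_ _. True"] by blast
  have "b2 \<in> U1"
  proof (rule ccontr)
    assume "b2 \<notin> U1"
    then have "2 \<le> card {e\<in>E. inside e B \<and> dir e U1 \<noteq> 0}"
      using U1(1,2) B(3) by (intro cut) auto
    moreover have "{e\<in>E. inside e B \<and> dir e U1 \<noteq> 0} = {}" using U1(4) by auto
    ultimately show False by (simp only: card.empty)
  qed
  then obtain p1 where p1: "unit_path p1 b1 b2"
    "\<And>e. e \<in> E \<Longrightarrow> p1 e \<in> {-1, 0, 1}" "\<And>e. e \<in> E \<Longrightarrow> p1 e \<noteq> 0 \<Longrightarrow> inside e B"
    using U1(2,3) unfolding arc_path_def inside_def by blast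
  \<comment> \<open>Reachability in the residual graph of \<open>p1\<close>: an edge may be used
    unless \<open>p1\<close> already uses it in the same direction.\<close>
  obtain U2 where U2: "b1 \<in> U2" "U2 \<subseteq> B"
    "\<forall>u\<in>U2. \<exists>p. arc_path (\<lambda>e s. p1 e \<noteq> s) U2 p b1 u"
    "\<forall>e\<in>E. inside e B \<and> dir e U2 \<noteq> 0 \<longrightarrow> \<not> p1 e \<noteq> dir e U2"
    using reachable_set[OF B(2,1), of "\<lambda>e s. p1 e \<noteq> s"] by blast
  have "b2 \<in> U2"
  proof (rule ccontr)
    assume b2: "b2 \<notin> U2"
    let ?D = "{e\<in>E. inside e B \<and> dir e U2 \<noteq> 0}"
    have "2 \<le> card ?D" using U2(1,2) B(3) b2 by (intro cut) auto
    \<comment> \<open>If \<open>b2\<close> were unreachable, every edge of the cut inside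
      \<open>B\<close> would carry one unit of \<open>p1\<close> outwards. That makes at least two
      units, but \<open>p1\<close> sends only one.\<close>
    have "net p1 U2 = (\<Sum>e\<in>?D. p1 e * dir e U2)" unfolding net_def
      by (rule sum.mono_neutral_right) (use p1(3) in auto)
    also have "\<dots> = (\<Sum>e\<in>?D. 1)"
    proof (rule sum.cong[OF refl])
      fix e assume "e \<in> ?D"
      then have "p1 e = dir e U2" "dir e U2 \<noteq> 0" using U2(4) by auto
      then show "p1 e * dir e U2 = 1" using dir_cases[of e U2] by auto
    qed
    finally have "net p1 U2 = int (card ?D)" by simp
    moreover have "net p1 U2 = 1" using unit_path_net[OF p1(1) finB[OF U2(2)]] U2(1) b2 by simp
    ultimately show False using \<open>2 \<le> card ?D\<close> by linarith
  qed
  then obtain p2 where p2: "unit_path p2 b1 b2"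
    "\<And>e. e \<in> E \<Longrightarrow> p2 e \<in> {-1, 0, 1}" "\<And>e. e \<in> E \<Longrightarrow> p2 e \<noteq> 0 \<Longrightarrow> inside e U2"
    "\<And>e. e \<in> E \<Longrightarrow> p2 e \<noteq> 0 \<Longrightarrow> p1 e \<noteq> p2 e"
    using U2(3) unfolding arc_path_def by blast
  \<comment> \<open>Opposite uses of an edge cancel and equal uses are excluded, so \<open>q\<close>
    has values in {-1, 0, 1}. It sends two units from \<open>b1\<close> to \<open>b2\<close>, so its
    net at each vertex is even.\<close>
  define q where "q e = p1 e + p2 e" for e
  have q: "q e \<in> {-1, 0, 1}" if "e \<in> E" for e
    using p1(2)[OF that] p2(2)[OF that] p2(4)[OF that] by (auto simp: q_def)
  have q_B: "inside e B" if "e \<in> E" "q e \<noteq> 0" for e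
  proof (cases "p1 e = 0")
    case True
    then have "inside e U2" using p2(3)[OF that(1)] that(2) by (simp add: q_def)
    then show ?thesis using U2(2) by (auto simp: inside_def)
  next
    case False
    then show ?thesis using p1(3) that by auto
  qed
  have q_net: "net q S = net p1 S + net p2 S" for S
    unfolding q_def by (rule net_add)
  obtain W where W: "b1 \<in> W" "W \<subseteq> B"
    "\<forall>u\<in>W. \<exists>p. arc_path (\<lambda>e s. q e \<noteq> 0) W p b1 u"
    "\<forall>e\<in>E. inside e B \<and> dir e W \<noteq> 0 \<longrightarrow> \<not> q e \<noteq> 0"
    using reachable_set[OF B(2,1), of "\<lambda>e s. q e \<noteq> 0"] by blast
  have leave: "q e * dir e W = 0" if "e \<in> E" for e
    using W(4) q_B that by force
  have "b2 \<in> W"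
  proof (rule ccontr)
    assume "b2 \<notin> W"
    have "net q W = 0" unfolding net_def by (rule sum.neutral) (use leave in blast)
    then show False
      using unit_path_net[OF p1(1) finB[OF W(2)]] unit_path_net[OF p2(1) finB[OF W(2)]]
        W(1) \<open>b2 \<notin> W\<close> q_net by simp
  qed
  \<comment> \<open>\<open>W\<close> is the component of \<open>b1\<close> in the support of
    \<open>q\<close>. No edge of the support leaves \<open>W\<close>, so discarding the rest keeps
    the net at each vertex of \<open>W\<close> and makes the support connected.\<close>
  define y where "y e = (if inside e W then q e else 0)" for e
  have "even (net y {v})" for v
  proof (cases "v \<in> W")
    case True
    have "net y {v} = net q {v}" unfolding net_def
    proof (rule sum.cong[OF refl])
      fix e assume "e \<in> E"
      show "y e * dir e {v} = q e * dir e {v}"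
        using leave[OF \<open>e \<in> E\<close>] True by (auto simp: y_def inside_def dir_def)
    qed
    also have "\<dots> = 2 * net p1 {v}" using q_net p1(1) p2(1) by (simp add: unit_path_def)
    finally show ?thesis by simp
  next
    case False
    have "net y {v} = 0" unfolding net_def
      by (rule sum.neutral) (use False in \<open>auto simp: y_def inside_def dir_def\<close>)
    then show ?thesis by simp
  qed
  moreover have "\<exists>p. unit_path p b1 w \<and> (\<forall>e\<in>E. p e \<noteq> 0 \<longrightarrow> odd (y e))" if w: "w \<in> W" for w
  proof -
    obtain p where "unit_path p b1 w" "\<And>e. e \<in> E \<Longrightarrow> p e \<noteq> 0 \<Longrightarrow> inside e W \<and> q e \<noteq> 0"
      using bspec[OF W(3) w] unfolding arc_path_def by (elim exE conjE) auto
    then show ?thesis using q by (intro exI[of _ p]) (force simp: y_def)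
  qed
  ultimately show thesis
    using that[of W y] W(1,2) \<open>b2 \<in> W\<close> by (auto simp: y_def)
qed

section \<open>Seymour's construction\<close>

lemma circulation_add: "circulation f \<Longrightarrow> circulation g \<Longrightarrow> circulation (\<lambda>e. f e + g e)"
  by (simp add: circulation_def net_add)

lemma circulation_scale: "circulation f \<Longrightarrow> circulation (\<lambda>e. k * f e)"
  by (simp add: circulation_def net_scale)

lemma circulation_sum: "(\<And>i. i \<in> I \<Longrightarrow> circulation (f i)) \<Longrightarrow> circulation (\<lambda>e. \<Sum>i\<in>I. f i e)"
  by (simp add: circulation_def net_sum)

lemma circulation_closed_path: "unit_path p a a \<Longrightarrow> circulation p"
  by (simp add: circulation_def unit_path_def)

definition supported :: "('e \<Rightarrow> int) \<Rightarrow> 'v set \<Rightarrow> bool" where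
  "supported f U \<longleftrightarrow> (\<forall>e\<in>E. f e \<noteq> 0 \<longrightarrow> inside e U)"

text \<open>The invariant of Seymour's construction. The odd edges of c form an even subgraph, and the
arbitrary offset f is what makes the invariant inductive: the edges already treated can be
repaired after circuits through later edges have disturbed them.\<close>

definition six_flow_state :: "'v set \<Rightarrow> ('e \<Rightarrow> int) \<Rightarrow> bool" where
  "six_flow_state U c \<longleftrightarrow> U \<subseteq> V \<and> supported c U \<and> (\<forall>v. even (net c {v})) \<and>
     (\<exists>a\<in>U. \<forall>u\<in>U. \<exists>p. unit_path p a u \<and> supported p U) \<and>
     (\<forall>f. \<exists>h. circulation h \<and> supported h U \<and>
        (\<forall>e\<in>E. inside e U \<and> even (c e) \<longrightarrow> \<not> 3 dvd f e + h e))"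

lemma six_flow_state_singleton:
  assumes "a \<in> V" shows "six_flow_state {a} (\<lambda>e. 0)"
proof -
  have "\<not> inside e {a}" if "e \<in> E" for e
    using no_loop[OF that] by (auto simp: inside_def)
  then show ?thesis
    using assms unit_path_refl
    by (auto simp: six_flow_state_def supported_def circulation_def intro: exI[of _ "\<lambda>e. 0"])
qed

text \<open>Since \<open>s\<close> and \<open>t\<close> are units modulo 3, each condition excludes
  one residue of \<open>k\<close>, and a third residue remains.\<close>

lemma avoid_two_residues:
  fixes x y s t :: int
  assumes "s = 1 \<or> s = -1" "t = 1 \<or> t = -1"
  obtains k where "\<not> 3 dvd x + k * s" "\<not> 3 dvd y + k * t"
proof -
  have "(\<not> 3 dvd x + 0 * s \<and> \<not> 3 dvd y + 0 * t) \<or> (\<not> 3 dvd x + 1 * s \<and> \<not> 3 dvd y + 1 * t) \<or>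
    (\<not> 3 dvd x + 2 * s \<and> \<not> 3 dvd y + 2 * t)"
    using assms by (elim disjE; simp; presburger)
  then show thesis using that by blast
qed

text \<open>An even connected subgraph \<open>y\<close> on \<open>W\<close> inside \<open>B\<close>
  links the ends of \<open>e1\<close> and \<open>e2\<close>, and \<open>W\<close> joins the treated
  set. New edges outside \<open>y\<close> are corrected in order: all but \<open>e1\<close> and
  \<open>e2\<close> by their own circuits, then \<open>e1\<close> and \<open>e2\<close> together by
  one circuit through both. The invariant finally repairs the edges inside \<open>U\<close>.\<close>

lemma six_flow_state_extend:
  assumes st: "six_flow_state U c" and B: "B \<subseteq> V - U"
    and cut: "\<And>A. A \<subseteq> B \<Longrightarrow> A \<noteq> {} \<Longrightarrow> A \<noteq> B \<Longrightarrow> 2 \<le> card {e\<in>E. inside e B \<and> dir e A \<noteq> 0}"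
    and e1: "e1 \<in> E" "dir e1 B \<noteq> 0" "\<not> inside e1 (V - U)"
    and e2: "e2 \<in> E" "dir e2 B \<noteq> 0" "\<not> inside e2 (V - U)"
    and "e1 \<noteq> e2"
  shows "\<exists>U' c'. six_flow_state U' c' \<and> U \<subset> U'"
proof -
  obtain b1 u1 s1 where b1: "b1 \<in> B" "u1 \<notin> B" "(b1, u1) = ends e1 \<or> (u1, b1) = ends e1"
    "s1 = 1 \<or> s1 = -1" "unit_path (single e1 s1) b1 u1"
    using unit_path_leaving[OF e1(1,2)] by metis
  obtain b2 u2 s2 where b2: "b2 \<in> B" "u2 \<notin> B" "(b2, u2) = ends e2 \<or> (u2, b2) = ends e2"
    "s2 = 1 \<or> s2 = -1" "unit_path (single e2 s2) b2 u2"
    using unit_path_leaving[OF e2(1,2)] by metis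
  have u1: "u1 \<in> U"
    using e1 b1 B fst_in_V[OF e1(1)] snd_in_V[OF e1(1)] by (auto simp: inside_def prod_eq_iff)
  have u2: "u2 \<in> U"
    using e2 b2 B fst_in_V[OF e2(1)] snd_in_V[OF e2(1)] by (auto simp: inside_def prod_eq_iff)
  have BV: "B \<subseteq> V" using B by auto
  obtain W y where W: "b1 \<in> W" "b2 \<in> W" "W \<subseteq> B" and y_even: "\<And>v. even (net y {v})"
    and y_W: "\<And>e. e \<in> E \<Longrightarrow> \<not> inside e W \<Longrightarrow> y e = 0"
    and y_path: "\<And>w. w \<in> W \<Longrightarrow> \<exists>p. unit_path p b1 w \<and> (\<forall>e\<in>E. p e \<noteq> 0 \<longrightarrow> odd (y e))"
    using connected_even_subgraph[OF BV b1(1) b2(1) cut] by blast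
  have UV: "U \<subseteq> V" and c_U: "supported c U" and c_even: "\<And>v. even (net c {v})"
    and fix_U: "\<And>f. \<exists>h. circulation h \<and> supported h U \<and>
        (\<forall>e\<in>E. inside e U \<and> even (c e) \<longrightarrow> \<not> 3 dvd f e + h e)"
    using st unfolding six_flow_state_def by blast+
  obtain a where a: "a \<in> U" and a_path: "\<And>u. u \<in> U \<Longrightarrow> \<exists>p. unit_path p a u \<and> supported p U"
    using st unfolding six_flow_state_def by blast
  define U' where "U' = U \<union> W"
  define c' where "c' e = c e + y e" for e
  have disj: "U \<inter> W = {}" using W(3) B by auto
  have in_U': "inside e U'" if "inside e U \<or> e = e1 \<or> e = e2 \<or> odd (y e)" "e \<in> E" for e
    using that y_W[of e] b1(3) b2(3) u1 u2 W(1,2)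
    by (cases "inside e W") (auto simp: inside_def U'_def prod_eq_iff)
  have e_new: "\<not> inside e U" "y e = 0" if "e = e1 \<or> e = e2" for e
  proof -
    have "b1 \<notin> U" "b2 \<notin> U" "u1 \<notin> W" "u2 \<notin> W" using W disj u1 u2 by auto
    then have "\<not> inside e U \<and> \<not> inside e W"
      using that b1(3) b2(3) by (auto simp: inside_def prod_eq_iff)
    then show "\<not> inside e U" "y e = 0" using y_W e1(1) e2(1) that by auto
  qed
  \<comment> \<open>All these paths enter \<open>W\<close> through \<open>e1\<close> and then follow
    \<open>y\<close>, so outside \<open>U\<close> they meet no even edge of \<open>y\<close> except
    \<open>e1\<close>.\<close>
  have path: "\<exists>p. unit_path p a x \<and> (\<forall>e\<in>E. p e \<noteq> 0 \<longrightarrow> inside e U \<or> e = e1 \<or> odd (y e))"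
    if x: "x \<in> U'" for x
  proof (cases "x \<in> U")
    case True
    then show ?thesis using a_path unfolding supported_def by blast
  next
    case False
    then have "x \<in> W" using x by (simp add: U'_def)
    then obtain p q where p: "unit_path p b1 x" "\<forall>e\<in>E. p e \<noteq> 0 \<longrightarrow> odd (y e)"
      and q: "unit_path q a u1" "supported q U"
      using y_path a_path[OF u1] by blast
    have "unit_path (\<lambda>e. q e + - single e1 s1 e + p e) a x"
      by (rule unit_path_trans[OF unit_path_trans[OF q(1) unit_path_sym[OF b1(5)]] p(1)])
    moreover have "\<forall>e\<in>E. q e + - single e1 s1 e + p e \<noteq> 0 \<longrightarrow> inside e U \<or> e = e1 \<or> odd (y e)"
      using p(2) q(2) by (auto simp: supported_def single_def)
    ultimately show ?thesis by blast
  qed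
  \<comment> \<open>The new edges that need a value nonzero modulo 3: those inside \<open>U\<close>
    are left to the invariant, and those odd in \<open>y\<close> belong to the even
    subgraph.\<close>
  define N where "N = {e\<in>E. inside e U' \<and> \<not> inside e U \<and> even (y e)}"
  define M where "M = N - {e1, e2}"
  have "finite M" by (simp add: M_def N_def)
  \<comment> \<open>Fundamental circuits over the connected part formed by \<open>U\<close>,
    \<open>e1\<close> and \<open>y\<close>: each meets \<open>M\<close> only in its own edge, so the
    edges of \<open>M\<close> can be set independently.\<close>
  have "\<exists>z. circulation z \<and> supported z U' \<and> (\<forall>e'\<in>M. z e' = of_bool (e' = e))"
    if e: "e \<in> M" for e
  proof -
    have eE: "e \<in> E" and fU': "fst (ends e) \<in> U'" and sU': "snd (ends e) \<in> U'"
      and eU': "inside e U'"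
      using e by (auto simp: M_def N_def inside_def)
    obtain p where p: "unit_path p a (fst (ends e))"
      "\<forall>e\<in>E. p e \<noteq> 0 \<longrightarrow> inside e U \<or> e = e1 \<or> odd (y e)"
      using path[OF fU'] by (elim exE conjE)
    obtain q where q: "unit_path q a (snd (ends e))"
      "\<forall>e\<in>E. q e \<noteq> 0 \<longrightarrow> inside e U \<or> e = e1 \<or> odd (y e)"
      using path[OF sU'] by (elim exE conjE)
    define z where "z e' = p e' + single e 1 e' + - q e'" for e'
    have "unit_path z a a" unfolding z_def
      by (rule unit_path_trans[OF unit_path_trans[OF p(1) unit_path_single[OF eE]]
            unit_path_sym[OF q(1)]])
    then have "circulation z" by (rule circulation_closed_path)
    moreover have "supported z U'" unfolding supported_def
    proof (intro ballI impI)
      fix e' assume e': "e' \<in> E" "z e' \<noteq> 0"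
      then have "p e' \<noteq> 0 \<or> q e' \<noteq> 0 \<or> e' = e" by (auto simp: z_def single_def split: if_splits)
      then show "inside e' U'" using p(2) q(2) in_U' e' eU' by blast
    qed
    moreover have "z e' = of_bool (e' = e)" if "e' \<in> M" for e'
    proof -
      have "e' \<in> E" "\<not> (inside e' U \<or> e' = e1 \<or> odd (y e'))"
        using that by (auto simp: M_def N_def)
      then have "p e' = 0" "q e' = 0" using p(2) q(2) by blast+
      then show ?thesis by (simp add: z_def single_def)
    qed
    ultimately show ?thesis by blast
  qed
  then have "\<exists>z. \<forall>e\<in>M. circulation (z e) \<and> supported (z e) U' \<and>
      (\<forall>e'\<in>M. z e e' = of_bool (e' = e))"
    by (intro bchoice) blast
  then obtain z where z: "\<And>e. e \<in> M \<Longrightarrow> circulation (z e)" "\<And>e. e \<in> M \<Longrightarrow> supported (z e) U'"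
    "\<And>e e'. e \<in> M \<Longrightarrow> e' \<in> M \<Longrightarrow> z e e' = of_bool (e' = e)"
    by blast
  \<comment> \<open>The circuit runs through \<open>U\<close> to \<open>u1\<close>, over
    \<open>e1\<close> to \<open>b1\<close>, along \<open>y\<close> to \<open>b2\<close>, and over
    \<open>e2\<close> back to \<open>U\<close>. It traverses \<open>e1\<close> from
    \<open>u1\<close> to \<open>b1\<close>, hence the value \<open>- s1\<close>.\<close>
  obtain z2 where z2: "circulation z2" "supported z2 U'" "z2 e1 = - s1" "z2 e2 = s2"
    "\<And>e. e \<in> M \<Longrightarrow> z2 e = 0"
  proof -
    obtain p q r where p: "unit_path p b1 b2" "\<forall>e\<in>E. p e \<noteq> 0 \<longrightarrow> odd (y e)"
      and q: "unit_path q a u1" "supported q U" and r: "unit_path r a u2" "supported r U"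
      using y_path[OF W(2)] a_path[OF u1] a_path[OF u2] by blast
    define z2 where "z2 e = q e + - single e1 s1 e + p e + single e2 s2 e + - r e" for e
    have "unit_path z2 a a" unfolding z2_def
      by (rule unit_path_trans[OF unit_path_trans[OF unit_path_trans[OF unit_path_trans[OF
              q(1) unit_path_sym[OF b1(5)]] p(1)] b2(5)] unit_path_sym[OF r(1)]])
    then have "circulation z2" by (rule circulation_closed_path)
    moreover have "supported z2 U'" unfolding supported_def
    proof (intro ballI impI)
      fix e' assume e': "e' \<in> E" "z2 e' \<noteq> 0"
      then have "p e' \<noteq> 0 \<or> q e' \<noteq> 0 \<or> r e' \<noteq> 0 \<or> e' = e1 \<or> e' = e2"
        by (auto simp: z2_def single_def split: if_splits)
      then show "inside e' U'" using p(2) q(2) r(2) in_U' e' unfolding supported_def by blast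
    qed
    moreover have zero: "p e = 0 \<and> q e = 0 \<and> r e = 0" if "e \<in> E" "\<not> inside e U" "even (y e)" for e
      using that p(2) q(2) r(2) unfolding supported_def by blast
    have "z2 e1 = - s1" "z2 e2 = s2"
      using zero[OF e1(1)] zero[OF e2(1)] e_new[of e1] e_new[of e2] \<open>e1 \<noteq> e2\<close>
      by (auto simp: z2_def single_def)
    moreover have "z2 e = 0" if "e \<in> M" for e
      using zero[of e] that by (auto simp: M_def N_def z2_def single_def)
    ultimately show thesis using that by blast
  qed
  have "\<exists>h. circulation h \<and> supported h U' \<and>
        (\<forall>e\<in>E. inside e U' \<and> even (c' e) \<longrightarrow> \<not> 3 dvd f e + h e)" for f
  proof -
    \<comment> \<open>Coefficient 1 exactly where \<open>f\<close> is divisible by 3, so that the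
      sum is not. The side effect on \<open>e1\<close> does no harm because \<open>k\<close> is
      chosen afterwards.\<close>
    define h1 where "h1 e' = (\<Sum>e\<in>M. of_bool (3 dvd f e) * z e e')" for e'
    have h1: "circulation h1" unfolding h1_def
      by (intro circulation_sum circulation_scale z(1))
    have h1_U': "supported h1 U'" unfolding supported_def
    proof (intro ballI impI)
      fix e' assume e': "e' \<in> E" "h1 e' \<noteq> 0"
      then obtain e where "e \<in> M" "z e e' \<noteq> 0"
        unfolding h1_def by (metis (no_types, lifting) mult_eq_0_iff sum.neutral)
      then show "inside e' U'" using z(2) e'(1) unfolding supported_def by blast
    qed
    have h1_M: "h1 e' = of_bool (3 dvd f e')" if "e' \<in> M" for e'
    proof -
      have "h1 e' = (\<Sum>e\<in>M. if e = e' then of_bool (3 dvd f e) else 0)"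
        unfolding h1_def by (rule sum.cong) (use z(3) that in auto)
      then show ?thesis using that \<open>finite M\<close> by simp
    qed
    obtain k where k: "\<not> 3 dvd (f e1 + h1 e1) + k * - s1" "\<not> 3 dvd (f e2 + h1 e2) + k * s2"
      using avoid_two_residues[of "- s1" s2] b1(4) b2(4) by auto
    define h2 where "h2 e = h1 e + k * z2 e" for e
    have h2: "circulation h2"
      unfolding h2_def by (intro circulation_add h1 circulation_scale z2(1))
    have h2_U': "supported h2 U'"
      using h1_U' z2(2) by (auto simp: supported_def h2_def)
    have h2_N: "\<not> 3 dvd f e + h2 e" if "e \<in> N" for e
    proof (cases "e \<in> M")
      case True
      have "\<not> 3 dvd f e + of_bool (3 dvd f e)" by (auto simp: of_bool_def) presburger
      then show ?thesis using True h1_M z2(5) by (simp add: h2_def)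
    next
      case False
      then have "e = e1 \<or> e = e2" using that by (auto simp: M_def)
      moreover have "\<not> 3 dvd f e1 + h2 e1" "\<not> 3 dvd f e2 + h2 e2"
        unfolding h2_def z2(3,4) add.assoc[symmetric] by (fact k)+
      ultimately show ?thesis by blast
    qed
    \<comment> \<open>The offset now includes everything the circuits did inside \<open>U\<close>.
      As \<open>h3\<close> lives inside \<open>U\<close>, it preserves what was achieved on
      \<open>N\<close>.\<close>
    obtain h3 where h3: "circulation h3" "supported h3 U"
      "\<forall>e\<in>E. inside e U \<and> even (c e) \<longrightarrow> \<not> 3 dvd (f e + h2 e) + h3 e"
      using fix_U[of "\<lambda>e. f e + h2 e"] by blast
    have "\<not> 3 dvd f e + (h2 e + h3 e)" if e: "e \<in> E" "inside e U'" "even (c' e)" for e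
    proof (cases "inside e U")
      case True
      then have "\<not> inside e W" using disj by (auto simp: inside_def)
      then have "even (c e)" using e y_W by (simp add: c'_def)
      then show ?thesis using h3(3) e(1) True by (simp add: add.assoc)
    next
      case False
      then have "c e = 0" "h3 e = 0" using c_U h3(2) e(1) by (auto simp: supported_def)
      then have "e \<in> N" using e False by (simp add: N_def c'_def)
      then show ?thesis using h2_N \<open>h3 e = 0\<close> by simp
    qed
    moreover have "supported (\<lambda>e. h2 e + h3 e) U'"
      using h2_U' h3(2) in_U' unfolding supported_def by (metis add_0)
    ultimately show ?thesis using circulation_add[OF h2 h3(1)] by blast
  qed
  moreover have "U' \<subseteq> V" using UV W(3) BV by (auto simp: U'_def)
  moreover have "supported c' U'"
    unfolding supported_def
  proof (intro ballI impI)
    fix e assume "e \<in> E" "c' e \<noteq> 0"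
    then have "inside e U \<or> inside e W" using c_U y_W by (auto simp: supported_def c'_def)
    then show "inside e U'" by (auto simp: inside_def U'_def)
  qed
  moreover have "even (net c' {v})" for v
    using c_even y_even net_add[of c y "{v}"] by (simp add: c'_def[abs_def])
  moreover have "\<exists>a\<in>U'. \<forall>u\<in>U'. \<exists>p. unit_path p a u \<and> supported p U'"
  proof (intro bexI[of _ a] ballI)
    fix u assume u: "u \<in> U'"
    obtain p where "unit_path p a u" "\<forall>e\<in>E. p e \<noteq> 0 \<longrightarrow> inside e U \<or> e = e1 \<or> odd (y e)"
      using path[OF u] by (elim exE conjE)
    then show "\<exists>p. unit_path p a u \<and> supported p U'"
      using in_U' unfolding supported_def by (intro exI[of _ p]) auto
  qed (simp add: U'_def a)
  ultimately have "six_flow_state U' c'"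
    unfolding six_flow_state_def by (intro conjI allI)
  moreover have "b1 \<notin> U" "b1 \<in> U'" using W(1) disj by (auto simp: U'_def)
  ultimately show ?thesis unfolding U'_def by blast
qed

end

section \<open>Cuts and leaf blocks in three-edge-connected graphs\<close>

locale three_edge_connected = multigraph +
  assumes three_edge_connected: "k_edge_connected 3 V E ends"
begin

text \<open>Deleting fewer than three crossing edges leaves the graph connected; deleting all of
  them would trap every walk from \<open>u\<close> in \<open>S\<close>.\<close>

lemma three_le_card_cut:
  assumes "u \<in> S" "u \<in> V" "v \<in> V" "v \<notin> S"
  shows "3 \<le> card {e\<in>E. dir e S \<noteq> 0}"
proof (rule ccontr)
  let ?F = "{e\<in>E. dir e S \<noteq> 0}"
  assume "\<not> ?thesis"
  then have "card ?F < 3" by simp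
  moreover have "?F \<subseteq> E" by auto
  ultimately have "connected_graph V (E - ?F) ends"
    using three_edge_connected[unfolded k_edge_connected_def, rule_format, of ?F] by simp
  then have "(u, v) \<in> (undir_arcs (E - ?F) ends)\<^sup>*"
    using assms by (auto simp: connected_graph_def)
  then have "v \<in> S"
  proof (induction rule: rtrancl_induct)
    case (step x w)
    then show ?case
      by (auto simp: undir_arcs_def dir_def prod_eq_iff split: if_splits)
  qed (use assms in simp)
  then show False using assms by simp
qed

text \<open>A vertex set B outside U with at most one edge to the rest of the complement of U, taken
minimal, is a leaf of the bridge tree of that complement; three-edge-connectivity then forces two
edges from B to U.\<close>

lemma leaf_block:
  assumes U: "U \<subseteq> V" "U \<noteq> {}" "U \<noteq> V"
  obtains B e1 e2 where "B \<subseteq> V - U"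
    "\<And>A. A \<subseteq> B \<Longrightarrow> A \<noteq> {} \<Longrightarrow> A \<noteq> B \<Longrightarrow> 2 \<le> card {e\<in>E. inside e B \<and> dir e A \<noteq> 0}"
    "e1 \<in> E" "dir e1 B \<noteq> 0" "\<not> inside e1 (V - U)"
    "e2 \<in> E" "dir e2 B \<noteq> 0" "\<not> inside e2 (V - U)" "e1 \<noteq> e2"
proof -
  define X where "X A = {e\<in>E. inside e (V - U) \<and> dir e A \<noteq> 0}" for A
  define Q where "Q A \<longleftrightarrow> A \<subseteq> V - U \<and> A \<noteq> {} \<and> card (X A) \<le> 1" for A
  have finX: "finite (X A)" for A by (simp add: X_def)
  have "X (V - U) = {}" by (auto simp: X_def inside_def dir_def)
  then have "Q (V - U)" using U by (auto simp: Q_def)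
  then obtain B where B: "Q B" and min: "\<And>A. Q A \<Longrightarrow> card B \<le> card A"
    using ex_has_least_nat[of Q _ card] by blast
  have "finite B" using B finite_subset[of B V] by (auto simp: Q_def)
  have smaller: "2 \<le> card (X A)" if "A \<subseteq> B" "A \<noteq> {}" "A \<noteq> B" for A
  proof (rule ccontr)
    assume "\<not> ?thesis"
    then have "Q A" using that B by (auto simp: Q_def)
    moreover have "card A < card B" using that \<open>finite B\<close> by (intro psubset_card_mono) auto
    ultimately show False using min by force
  qed
  have cut: "2 \<le> card {e\<in>E. inside e B \<and> dir e A \<noteq> 0}"
    if A: "A \<subseteq> B" "A \<noteq> {}" "A \<noteq> B" for A
  proof (rule ccontr)
    let ?D = "{e\<in>E. inside e B \<and> dir e A \<noteq> 0}"
    assume "\<not> ?thesis"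
    then have D: "card ?D < 2" by simp
    have "\<exists>e\<in>X A'. e \<notin> ?D" if "2 \<le> card (X A')" for A'
    proof (rule ccontr)
      assume "\<not> ?thesis"
      then have "card (X A') \<le> card ?D" by (intro card_mono) auto
      then show False using that D by simp
    qed
    moreover have "2 \<le> card (X A)" "2 \<le> card (X (B - A))" using A by (auto intro!: smaller)
    ultimately obtain e e' where e: "e \<in> X A" "e \<notin> ?D" and e': "e' \<in> X (B - A)" "e' \<notin> ?D"
      by blast
    \<comment> \<open>Neither edge lies inside \<open>B\<close>, so both leave it, \<open>e\<close>
      from \<open>A\<close> and \<open>e'\<close> from \<open>B - A\<close>. This gives
      \<open>B\<close> two edges to the rest of the complement, one too many.\<close>
    have "{e, e'} \<subseteq> X B" "e \<noteq> e'"
      using e e' A(1) unfolding X_def mem_Collect_eq dir_nonzero_iff inside_def by blast+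
    then have "2 \<le> card (X B)" using card_mono[OF finX, of "{e, e'}" B] by simp
    then show False using B by (simp add: Q_def)
  qed
  let ?Y = "{e\<in>E. dir e B \<noteq> 0 \<and> \<not> inside e (V - U)}"
  obtain b u where "b \<in> B" "b \<in> V" "u \<in> V" "u \<notin> B"
    using B U by (auto simp: Q_def)
  then have "3 \<le> card {e\<in>E. dir e B \<noteq> 0}" by (rule three_le_card_cut)
  also have "{e\<in>E. dir e B \<noteq> 0} = X B \<union> ?Y" by (auto simp: X_def)
  also have "card \<dots> \<le> card (X B) + card ?Y" by (rule card_Un_le)
  finally have "2 \<le> card ?Y" using B by (simp add: Q_def)
  then obtain T where T: "T \<subseteq> ?Y" "card T = 2" by (rule obtain_subset_with_card_n)
  then obtain e1 e2 where "T = {e1, e2}" "e1 \<noteq> e2" by (auto simp: card_2_iff)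
  then have "e1 \<in> ?Y" "e2 \<in> ?Y" "e1 \<noteq> e2" using T(1) by auto
  then show thesis using that[of B e1 e2] B cut by (auto simp: Q_def)
qed

text \<open>A maximal treated set is all of \<open>V\<close>, since a leaf block of its complement
  would extend it. Offset zero then yields the ternary flow; the parity of \<open>c\<close> encodes
  the even subgraph.\<close>

lemma even_subgraph_and_ternary_flow:
  assumes "V \<noteq> {}"
  obtains c h where "\<And>v. even (net c {v})" "circulation h" "\<And>e. e \<in> E \<Longrightarrow> even (c e) \<Longrightarrow> \<not> 3 dvd h e"
proof -
  obtain a where "a \<in> V" using assms by blast
  define P where "P U \<longleftrightarrow> (\<exists>c. six_flow_state U c)" for U
  have sub: "U \<subseteq> V" if "P U" for U using that by (auto simp: P_def six_flow_state_def)
  have fin: "finite {U. P U}"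
    by (rule finite_subset[of _ "Pow V"]) (use sub in auto)
  have "P {a}" using six_flow_state_singleton[OF \<open>a \<in> V\<close>] by (auto simp: P_def)
  then obtain U where U: "P U" and max: "\<And>U'. P U' \<Longrightarrow> U \<subseteq> U' \<Longrightarrow> U' = U"
    using finite_has_maximal[OF fin] by blast
  obtain c where c: "six_flow_state U c" using U by (auto simp: P_def)
  have "U = V"
  proof (rule ccontr)
    assume "U \<noteq> V"
    have "U \<noteq> {}" using c by (auto simp: six_flow_state_def)
    have "\<exists>U' c'. six_flow_state U' c' \<and> U \<subset> U'"
    proof (rule leaf_block[OF sub[OF U] \<open>U \<noteq> {}\<close> \<open>U \<noteq> V\<close>])
      fix B e1 e2
      assume "B \<subseteq> V - U"
        "\<And>A. A \<subseteq> B \<Longrightarrow> A \<noteq> {} \<Longrightarrow> A \<noteq> B \<Longrightarrow> 2 \<le> card {e\<in>E. inside e B \<and> dir e A \<noteq> 0}"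
        "e1 \<in> E" "dir e1 B \<noteq> 0" "\<not> inside e1 (V - U)"
        "e2 \<in> E" "dir e2 B \<noteq> 0" "\<not> inside e2 (V - U)" "e1 \<noteq> e2"
      then show ?thesis by (rule six_flow_state_extend[OF c])
    qed
    then show False using max by (auto simp: P_def)
  qed
  have "\<forall>f. \<exists>h. circulation h \<and> supported h V \<and>
      (\<forall>e\<in>E. inside e V \<and> even (c e) \<longrightarrow> \<not> 3 dvd f e + h e)"
    using c \<open>U = V\<close> by (simp add: six_flow_state_def)
  from spec[OF this, of "\<lambda>e. 0"]
  obtain h where "circulation h" "\<forall>e\<in>E. inside e V \<and> even (c e) \<longrightarrow> \<not> 3 dvd h e"
    by auto
  then show thesis
    using that[of c h] c by (auto simp: six_flow_state_def inside_def fst_in_V snd_in_V)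
qed

section \<open>Deletable edges\<close>

text \<open>If the deletion is not strong, some cut has all edges but possibly e pointing inwards, and
there are at least two of those, so the flow value of e would have to be at least two.\<close>

lemma deletable_of_unit_value:
  assumes F: "circulation F" "\<And>e. e \<in> E \<Longrightarrow> F e \<noteq> 0"
    and e: "e \<in> E" "\<bar>F e\<bar> = 1"
  shows "deletable V E ends (\<lambda>e. F e > 0) e"
  unfolding deletable_def strong_def
proof (intro ballI impI, rule ccontr)
  fix u v
  let ?R = "arcs (E - {e}) ends (\<lambda>e. F e > 0)"
  assume uv: "u \<in> V" "v \<in> V" "u \<noteq> v" "(u, v) \<notin> ?R\<^sup>+"
  \<comment> \<open>\<open>S\<close> is what \<open>u\<close> reaches without \<open>e\<close>, so
    every other edge of its cut is directed into \<open>S\<close> and contributes at most -1 to the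
    net outflow.\<close>
  define S where "S = {w\<in>V. (u, w) \<in> ?R\<^sup>*}"
  have S: "u \<in> S" "v \<notin> S" "finite S" using uv by (auto simp: S_def rtrancl_eq_or_trancl)
  let ?C = "{e\<in>E. dir e S \<noteq> 0}"
  have closed: "w \<in> S" if "x \<in> S" "(x, w) \<in> ?R" "w \<in> V" for x w
    using that by (auto simp: S_def intro: rtrancl_into_rtrancl)
  have le: "F e' * dir e' S \<le> -1" if "e' \<in> ?C - {e}" for e'
  proof -
    have e': "e' \<in> E" "e' \<noteq> e" "dir e' S \<noteq> 0" using that by auto
    have "(if F e' > 0 then ends e' else prod.swap (ends e')) \<in> ?R"
      unfolding arcs_def using e' by blast
    then have "if F e' > 0 then (fst (ends e'), snd (ends e')) \<in> ?R
        else (snd (ends e'), fst (ends e')) \<in> ?R"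
      by (auto simp: prod.swap_def split: if_splits)
    then have "if F e' > 0 then fst (ends e') \<in> S \<longrightarrow> snd (ends e') \<in> S
        else snd (ends e') \<in> S \<longrightarrow> fst (ends e') \<in> S"
      using closed[of "fst (ends e')" "snd (ends e')"] closed[of "snd (ends e')" "fst (ends e')"]
        fst_in_V[OF e'(1)] snd_in_V[OF e'(1)]
      by (simp split: if_splits)
    then have "F e' > 0 \<and> dir e' S = -1 \<or> F e' \<le> 0 \<and> dir e' S = 1"
      using e'(3) by (auto simp: dir_def split: if_splits)
    then show ?thesis using F(2)[OF e'(1)] by auto
  qed
  have "3 \<le> card ?C" by (rule three_le_card_cut[OF S(1) uv(1,2) S(2)])
  then have card: "2 \<le> card (?C - {e})" by (cases "e \<in> ?C") auto
  have "net F S = 0" using circulation_net[OF F(1) S(3)] .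
  moreover have "net F S = F e * dir e S + (\<Sum>e'\<in>E - {e}. F e' * dir e' S)"
    unfolding net_def by (rule sum.remove) (use e in auto)
  moreover have "(\<Sum>e'\<in>E - {e}. F e' * dir e' S) = (\<Sum>e'\<in>?C - {e}. F e' * dir e' S)"
    by (rule sum.mono_neutral_right) auto
  moreover have "\<dots> \<le> (\<Sum>e'\<in>?C - {e}. -1)" using le by (rule sum_mono)
  moreover have "F e * dir e S \<le> 1" using e(2) dir_cases[of e S] by auto
  ultimately show False using card by simp
qed

section \<open>Combination into four flows\<close>

text \<open>The point of h' is that it is a flow congruent to h modulo 3 with the same support and
modulus at most 2, but with modulus 1 and the opposite sign wherever h has modulus 2.\<close>

lemma four_flows:
  assumes "V \<noteq> {}"
  obtains Fs where "length Fs = 4"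
    "\<And>F. F \<in> set Fs \<Longrightarrow> circulation F \<and> (\<forall>e\<in>E. F e \<noteq> 0)"
    "\<And>e. e \<in> E \<Longrightarrow> \<exists>F\<in>set Fs. \<bar>F e\<bar> = 1"
proof -
  obtain c h0 where c: "\<And>v. even (net c {v})" and h0: "circulation h0"
    and nz: "\<And>e. e \<in> E \<Longrightarrow> even (c e) \<Longrightarrow> \<not> 3 dvd h0 e"
    using even_subgraph_and_ternary_flow[OF assms] by metis
  obtain g where g: "circulation g" "\<And>e. e \<in> E \<Longrightarrow> even (c e - g e)" "\<And>e. e \<in> E \<Longrightarrow> \<bar>g e\<bar> < 2"
    using modular_flow_rounding[of 2 c] c by auto
  obtain h where h: "circulation h" "\<And>e. e \<in> E \<Longrightarrow> 3 dvd h0 e - h e" "\<And>e. e \<in> E \<Longrightarrow> \<bar>h e\<bar> < 3"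
    using modular_flow_rounding[of 3 h0] h0 by (auto simp: circulation_def)
  obtain k where k: "circulation k" "\<And>e. e \<in> E \<Longrightarrow> even (h e - k e)" "\<And>e. e \<in> E \<Longrightarrow> \<bar>k e\<bar> < 2"
    using modular_flow_rounding[of 2 h] h(1) by (auto simp: circulation_def)
  \<comment> \<open>The division is exact on \<open>E\<close>, where \<open>h\<close> and
    \<open>k\<close> have equal parity.\<close>
  define h' where "h' e = - ((h e + 3 * k e) div 2)" for e
  have h'_eq: "2 * h' e = - h e - 3 * k e" if "e \<in> E" for e
  proof -
    have "even (h e + 3 * k e)" using k(2)[OF that] by presburger
    then show ?thesis unfolding h'_def by presburger
  qed
  have "2 * net h' {v} = 0" for v
  proof -
    have "2 * net h' {v} = net (\<lambda>e. - h e - 3 * k e) {v}"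
      unfolding net_scale[symmetric] using h'_eq by (intro net_cong) auto
    also have "\<dots> = 0"
      using h(1) k(1) by (simp add: net_diff net_uminus net_scale circulation_def)
    finally show ?thesis .
  qed
  then have h': "circulation h'" by (simp add: circulation_def)
  \<comment> \<open>If \<open>g e = 0\<close>, then \<open>h e\<close> or \<open>h' e\<close> has
    modulus 1 and all values are nonzero. Otherwise the first two are nonzero because
    \<open>h\<close> and \<open>h'\<close> have modulus at most 2, and the last two are odd. The
    first has modulus 1 at \<open>h = 2g\<close>, the third at \<open>h = 0\<close> and
    \<open>h = -g\<close>. For \<open>h = g\<close> or \<open>h = -2g\<close>, \<open>h'\<close> is
    \<open>g\<close> or \<open>-2g\<close>, which the fourth and the second flow cover.\<close>
  define Fs where "Fs = [\<lambda>e. -3 * g e + h e, \<lambda>e. 3 * g e + h' e, \<lambda>e. 2 * h e + g e,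
    \<lambda>e. 2 * h' e + -1 * g e]"
  have circ: "circulation F" if "F \<in> set Fs" for F
    using that unfolding Fs_def
    by (auto simp only: list.set insert_iff empty_iff
        intro!: circulation_add circulation_scale g(1) h(1) h')
  have main: "(\<forall>F\<in>set Fs. F e \<noteq> 0) \<and> (\<exists>F\<in>set Fs. \<bar>F e\<bar> = 1)" if e: "e \<in> E" for e
  proof -
    have "g e \<noteq> 0 \<or> h e \<noteq> 0"
    proof (rule ccontr)
      assume "\<not> ?thesis"
      then have "even (c e)" "3 dvd h0 e" using g(2)[OF e] h(2)[OF e] by auto
      then show False using nz e by auto
    qed
    moreover have "g e \<in> {-1, 0, 1}" using g(3)[OF e] by auto
    moreover have "h e \<in> {-2, -1, 0, 1, 2}" using h(3)[OF e] by auto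
    moreover have "k e \<in> {-1, 0, 1}" using k(3)[OF e] by auto
    ultimately show ?thesis using h'_eq[OF e] k(2)[OF e] unfolding Fs_def
      by (elim insertE emptyE) auto
  qed
  show thesis by (rule that[of Fs]) (use circ main in \<open>auto simp: Fs_def\<close>)
qed

end

theorem theorem1:
  fixes V :: "'v set" and E :: "'e set" and ends :: "'e \<Rightarrow> 'v \<times> 'v"
  assumes "graph V E ends"
    and "k_edge_connected 3 V E ends"
  shows "frank_number V E ends \<le> 4"
proof -
  interpret three_edge_connected V E ends
    using assms by unfold_locales
  have "\<exists>os. length os = 4 \<and> (\<forall>e\<in>E. \<exists>ori\<in>set os. deletable V E ends ori e)"
  \<comment> \<open>Seymour's construction needs a start vertex, so the empty graph is treated
    separately.\<close>
  proof (cases "V = {}")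
    case True
    then have "E = {}" using fst_in_V by auto
    then show ?thesis by (auto intro: exI[of _ "replicate 4 (\<lambda>_. True)"])
  next
    case False
    then obtain Fs where Fs: "length Fs = 4"
      "\<And>F. F \<in> set Fs \<Longrightarrow> circulation F \<and> (\<forall>e\<in>E. F e \<noteq> 0)"
      "\<And>e. e \<in> E \<Longrightarrow> \<exists>F\<in>set Fs. \<bar>F e\<bar> = 1"
      using four_flows by metis
    show ?thesis
    proof (intro exI[of _ "map (\<lambda>F e. F e > 0) Fs"] conjI ballI)
      fix e assume e: "e \<in> E"
      obtain F where F: "F \<in> set Fs" "\<bar>F e\<bar> = 1" using Fs(3)[OF e] by blast
      then have "deletable V E ends (\<lambda>e. F e > 0) e"
        using Fs(2) e by (intro deletable_of_unit_value) auto
      then show "\<exists>ori\<in>set (map (\<lambda>F e. F e > 0) Fs). deletable V E ends ori e"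
        using F(1) by auto
    qed (simp add: Fs(1))
  qed
  then show ?thesis unfolding frank_number_def by (rule Least_le)
qed

end
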